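(* Let $r$ be an odd positive integer, let $j$ be an integer with $0\le j\le\lfloor r/2\rfloor$, let $\alpha\in\mathbb C$, and put $p:=(r-1-\alpha)/2$. Then $$\sum_{k=2j}^r2^{r-k}\binom{p}{r-k}\binom{\alpha}{k}m_{k,j}=0,$$ where $m_{k,j}:=\frac{k!}{(k-2j)!\,j!\,2^j}$ is the number of $j$-edge matchings of the complete graph $K_k$.
   Context: $\binom{\beta}{k}=\beta(\beta-1)\cdots(\beta-k+1)/k!$ for $\beta\in\mathbb C$. *)

theory Defs
  imports "HOL-Analysis.Analysis"
begin

text \<open>The formula is meaningful only for \<open>2 * j \<le> k\<close>, because the subtraction
  \<open>k - 2 * j\<close> on natural numbers truncates; the division is in \<open>complex\<close>.\<close>

definition matching_number :: "nat \<Rightarrow> nat \<Rightarrow> complex" where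
  "matching_number k j = fact k / (fact (k - 2 * j) * fact j * 2 ^ j)"

definition complete_edges :: "'a set \<Rightarrow> 'a set set" where
  "complete_edges V = {e. e \<subseteq> V \<and> card e = 2}"

definition complete_matchings :: "'a set \<Rightarrow> nat \<Rightarrow> 'a set set set" where
  "complete_matchings V j =
     {M. M \<subseteq> complete_edges V \<and> pairwise disjnt M \<and> finite M \<and> card M = j}"

lemma finite_complete_edges: "finite V \<Longrightarrow> finite (complete_edges V)"
  unfolding complete_edges_def by (rule finite_subset[of _ "Pow V"]) auto

lemma finite_complete_matchings: "finite V \<Longrightarrow> finite (complete_matchings V j)"
  by (rule finite_subset[of _ "Pow (complete_edges V)"])
     (auto simp: complete_matchings_def finite_complete_edges)

lemma complete_matchings_remove:
  assumes "M \<in> complete_matchings V (Suc j)" "e \<in> M"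
  shows "e \<in> complete_edges V" "M - {e} \<in> complete_matchings (V - e) j"
proof -
  have M: "M \<subseteq> complete_edges V" "pairwise disjnt M" "finite M" "card M = Suc j"
    using assms(1) by (auto simp: complete_matchings_def)
  show "e \<in> complete_edges V" using M assms(2) by auto
  have "f \<in> complete_edges (V - e)" if "f \<in> M - {e}" for f
  proof -
    have "disjnt e f" using M(2) assms(2) that by (auto simp: pairwise_def)
    thus ?thesis using M(1) that by (auto simp: complete_edges_def disjnt_def)
  qed
  thus "M - {e} \<in> complete_matchings (V - e) j"
    using M assms(2) by (auto simp: complete_matchings_def intro: pairwise_subset)
qed

lemma complete_matchings_insert:
  assumes "e \<in> complete_edges V" "N \<in> complete_matchings (V - e) j"
  shows "e \<notin> N" "insert e N \<in> complete_matchings V (Suc j)"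
proof -
  have N: "N \<subseteq> complete_edges (V - e)" "pairwise disjnt N" "finite N" "card N = j"
    using assms(2) by (auto simp: complete_matchings_def)
  have e: "e \<noteq> {}" using assms(1) by (auto simp: complete_edges_def)
  have d: "disjnt e f" if "f \<in> N" for f
    using N(1) that by (auto simp: complete_edges_def disjnt_def)
  show nin: "e \<notin> N" using d e by (auto simp: disjnt_def)
  have "pairwise disjnt (insert e N)"
    using d N(2) by (auto simp: pairwise_insert disjnt_sym)
  moreover have "N \<subseteq> complete_edges V" using N(1) by (auto simp: complete_edges_def)
  ultimately show "insert e N \<in> complete_matchings V (Suc j)"
    using N nin assms(1) by (auto simp: complete_matchings_def)
qed

lemma card_complete_matchings_Suc:
  assumes "finite V"
  shows "Suc j * card (complete_matchings V (Suc j)) =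
         (\<Sum>e\<in>complete_edges V. card (complete_matchings (V - e) j))"
proof -
  have "bij_betw (\<lambda>(M, e). (e, M - {e}))
          (Sigma (complete_matchings V (Suc j)) (\<lambda>M. M))
          (Sigma (complete_edges V) (\<lambda>e. complete_matchings (V - e) j))"
    by (rule bij_betw_byWitness[where f' = "\<lambda>(e, N). (insert e N, e)"])
       (use complete_matchings_remove complete_matchings_insert in \<open>fastforce+\<close>)
  hence "card (Sigma (complete_matchings V (Suc j)) (\<lambda>M. M)) =
         card (Sigma (complete_edges V) (\<lambda>e. complete_matchings (V - e) j))"
    by (rule bij_betw_same_card)
  moreover have "card (Sigma (complete_matchings V (Suc j)) (\<lambda>M. M)) =
      (\<Sum>M\<in>complete_matchings V (Suc j). card M)"
    using finite_complete_matchings[OF assms]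
    by (intro card_SigmaI) (auto simp: complete_matchings_def)
  moreover have "(\<Sum>M\<in>complete_matchings V (Suc j). card M) =
      Suc j * card (complete_matchings V (Suc j))"
    by (simp add: complete_matchings_def)
  moreover have "card (Sigma (complete_edges V) (\<lambda>e. complete_matchings (V - e) j)) =
      (\<Sum>e\<in>complete_edges V. card (complete_matchings (V - e) j))"
    using assms finite_complete_edges[OF assms]
    by (intro card_SigmaI) (auto intro: finite_complete_matchings)
  ultimately show ?thesis by simp
qed

lemma card_complete_matchings_mult:
  assumes "finite V" "2 * j \<le> card V"
  shows "card (complete_matchings V j) * (fact (card V - 2 * j) * fact j * 2 ^ j) = fact (card V)"
  using assms
proof (induction j arbitrary: V)
  case 0
  have "complete_matchings V 0 = {{}}" by (auto simp: complete_matchings_def)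
  thus ?case by simp
next
  case (Suc j)
  obtain k where k: "card V = Suc (Suc k)"
    using Suc.prems by (metis Suc_le_D mult_Suc_right add_2_eq_Suc le_Suc_eq Suc_le_mono)
  let ?A = "fact (k - 2 * j) * fact j * 2 ^ j :: nat"
  have IH: "card (complete_matchings (V - e) j) * ?A = fact k" if "e \<in> complete_edges V" for e
  proof -
    have "e \<subseteq> V" "card e = 2" using that by (auto simp: complete_edges_def)
    hence "card (V - e) = k"
      using k Suc.prems by (simp add: card_Diff_subset finite_subset)
    thus ?thesis using Suc.IH[of "V - e"] Suc.prems k by auto
  qed
  have "card (complete_edges V) = Suc (Suc k) choose 2"
    using n_subsets[OF Suc.prems(1), of 2] k by (simp add: complete_edges_def)
  hence ce: "2 * card (complete_edges V) = Suc (Suc k) * Suc k"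
    by (simp add: choose_two)
  have "card (complete_matchings V (Suc j)) *
          (fact (card V - 2 * Suc j) * fact (Suc j) * 2 ^ Suc j) =
        2 * (Suc j * card (complete_matchings V (Suc j))) * ?A"
    by (simp add: k algebra_simps)
  also have "\<dots> = 2 * (\<Sum>e\<in>complete_edges V. card (complete_matchings (V - e) j) * ?A)"
    by (simp only: card_complete_matchings_Suc[OF Suc.prems(1)] sum_distrib_right mult.assoc)
  also have "\<dots> = 2 * (\<Sum>e\<in>complete_edges V. fact k)"
    using IH by (intro arg_cong[of _ _ "(*) 2"] sum.cong) auto
  also have "\<dots> = fact (card V)"
    using ce by (simp add: k algebra_simps)
  finally show ?case .
qed

theorem matching_number_eq_card:
  assumes "finite V" "2 * j \<le> card V"
  shows "matching_number (card V) j = of_nat (card (complete_matchings V j))"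
proof -
  have "of_nat (card (complete_matchings V j)) *
          (fact (card V - 2 * j) * fact j * 2 ^ j) = (fact (card V) :: complex)"
    using arg_cong[OF card_complete_matchings_mult[OF assms], of "of_nat :: nat \<Rightarrow> complex"]
    by simp
  thus ?thesis by (simp add: matching_number_def field_simps)
qed

end

theory Submission
  imports Defs
begin

text \<open>The factor \<open>(\<alpha> gchoose k) * fact k / fact (k - 2 * j)\<close> is, up to a factor independent of
  \<open>k\<close>, the binomial coefficient of \<open>\<beta> = \<alpha> - 2 * j\<close> over \<open>k - 2 * j\<close>. With \<open>n = r - 2 * j\<close> the sum is
  a multiple of the coefficient of \<open>X\<^sup>n\<close> in \<open>(1 + 2 X)\<^sup>p (1 + X)\<^sup>\<beta>\<close>, where \<open>\<beta> = n - 1 - 2 * p\<close>. This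
  coefficient is a polynomial in \<open>p\<close>, so \<open>p\<close> may be taken to be a natural number. Expanding
  \<open>(1 + 2 X)\<^sup>p = ((1 + X)\<^sup>2 - X\<^sup>2)\<^sup>p\<close> leaves multiples of \<open>X ^ (2 * i) * (1 + X) ^ (n - 1 - 2 * i)\<close>.
  As \<open>n\<close> is odd, the exponent \<open>n - 1 - 2 * i\<close> is a natural number if \<open>2 * i \<le> n\<close>, and the degree is then
  \<open>n - 1 < n\<close>.\<close>

lemma fps_nth_one_plus_two_X_power:
  "fps_nth ((1 + 2 * fps_X) ^ p) k = (2 ^ k * (of_nat p gchoose k) :: 'a :: field_char_0)"
proof -
  have "(1 + 2 * fps_X) ^ p = (\<Sum>i\<le>p. fps_const (of_nat (p choose i) * 2 ^ i) * fps_X ^ i :: 'a fps)"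
    unfolding add.commute[of 1] binomial_ring
    by (simp add: power_mult_distrib fps_of_nat fps_const_mult[symmetric] fps_const_power[symmetric]
        numeral_fps_const mult_ac del: fps_const_mult fps_const_power)
  then show ?thesis
    by (simp add: fps_sum_nth fps_X_power_nth if_distrib[of "(*) _"] sum.delta binomial_gbinomial
        binomial_eq_0 mult_ac flip: binomial_gbinomial cong: if_cong)
qed

lemma sum_gchoose_of_nat_eq_0:
  fixes n p :: nat
  assumes "odd n"
  shows "(\<Sum>m=0..n. 2 ^ (n - m) * (of_nat p gchoose (n - m)) *
           ((of_nat n - 1 - 2 * of_nat p) gchoose m)) = (0 :: 'a :: field_char_0)"
proof -
  define \<beta> :: 'a where "\<beta> = of_nat n - 1 - 2 * of_nat p"
  let ?B = "fps_binomial :: 'a \<Rightarrow> 'a fps"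
  have eq: "(1 + 2 * fps_X :: 'a fps) = - (fps_X ^ 2) + (1 + fps_X) ^ 2"
    by (simp add: power2_eq_square algebra_simps)
  \<comment> \<open>The exponents add up to \<open>2 * (p - i) + \<beta>\<close>, where
    \<open>p\<close> cancels.\<close>
  have B: "((1 + fps_X) ^ 2) ^ (p - i) * ?B \<beta> = ?B (of_nat n - 1 - 2 * of_nat i)" if "i \<le> p" for i
  proof -
    have "((1 + fps_X) ^ 2) ^ (p - i) * ?B \<beta> = ?B (of_nat (2 * (p - i))) * ?B \<beta>"
      by (simp only: fps_binomial_of_nat power_mult)
    also have "\<dots> = ?B (of_nat (2 * (p - i)) + \<beta>)"
      by (rule fps_binomial_add_mult[symmetric])
    finally show ?thesis
      using that by (simp add: \<beta>_def of_nat_diff algebra_simps)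
  qed
  have "(1 + 2 * fps_X) ^ p * ?B \<beta> = (\<Sum>i\<le>p. of_nat (p choose i) * (- (fps_X ^ 2)) ^ i *
      (((1 + fps_X) ^ 2) ^ (p - i) * ?B \<beta>))"
    unfolding eq binomial_ring by (simp add: sum_distrib_right mult.assoc)
  also have "\<dots> = (\<Sum>i\<le>p. fps_X ^ (2 * i) *
      (fps_const (of_nat (p choose i) * (- 1) ^ i) * ?B (of_nat n - 1 - 2 * of_nat i)))"
  proof (rule sum.cong)
    fix i assume "i \<in> {..p}"
    have X: "(- (fps_X ^ 2)) ^ i = fps_const ((- 1) ^ i) * (fps_X ^ (2 * i) :: 'a fps)"
      by (subst power_minus) (simp add: power_mult flip: fps_const_power fps_const_neg)
    show "of_nat (p choose i) * (- (fps_X ^ 2)) ^ i * (((1 + fps_X) ^ 2) ^ (p - i) * ?B \<beta>) =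
      fps_X ^ (2 * i) * (fps_const (of_nat (p choose i) * (- 1) ^ i) * ?B (of_nat n - 1 - 2 * of_nat i))"
      unfolding X B[OF \<open>i \<in> {..p}\<close>[unfolded atMost_iff]]
      by (simp only: fps_of_nat[symmetric] fps_const_mult[symmetric] mult_ac)
  qed simp
  finally have "fps_nth ((1 + 2 * fps_X) ^ p * ?B \<beta>) n = (\<Sum>i\<le>p. if n < 2 * i then 0 else
      of_nat (p choose i) * (- 1) ^ i * ((of_nat n - 1 - 2 * of_nat i) gchoose (n - 2 * i)))"
    by (simp add: fps_sum_nth fps_X_power_mult_nth fps_mult_left_const_nth
        cong: if_cong)
  also have "\<dots> = 0"
  proof (intro sum.neutral ballI)
    fix i
    have "((of_nat n - 1 - 2 * of_nat i :: 'a) gchoose (n - 2 * i)) = 0" if "\<not> n < 2 * i"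
    proof -
      \<comment> \<open>Oddness excludes \<open>n = 2 * i\<close>, where the exponent would be -1
        and the coefficient 1 instead of 0.\<close>
      have "2 * i < n" using that assms by (metis dvd_triv_left linorder_neqE_nat)
      then have "(of_nat n - 1 - 2 * of_nat i :: 'a) = of_nat (n - 2 * i - 1)"
        by (simp add: of_nat_diff)
      then show ?thesis
        using \<open>2 * i < n\<close> by (simp only: binomial_gbinomial[symmetric]) (simp add: binomial_eq_0)
    qed
    then show "(if n < 2 * i then 0 else of_nat (p choose i) * (- 1) ^ i *
        ((of_nat n - 1 - 2 * of_nat i) gchoose (n - 2 * i))) = (0 :: 'a)"
      by simp
  qed
  \<comment> \<open>With \<open>?B \<beta>\<close> as the first factor, the convolution index
    \<open>m\<close> lands on \<open>\<beta>\<close>, as in the claim.\<close>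
  finally have "fps_nth (?B \<beta> * (1 + 2 * fps_X) ^ p) n = 0"
    by (subst mult.commute)
  then show ?thesis
    unfolding fps_mult_nth fps_nth_one_plus_two_X_power fps_binomial_nth \<beta>_def
    by (simp only: mult_ac)
qed

text \<open>Supplies an actual \<open>poly\<close> object, so that root counting applies to the sum
  below.\<close>

lemma gchoose_linear_eq_poly:
  "(c + d * x) gchoose k = poly (smult (inverse (fact k)) (\<Prod>i=0..<k. [:c - of_nat i, d:])) x"
  for c d x :: "'a :: field_char_0"
  by (simp add: gbinomial_prod_rev poly_prod field_simps)

lemma sum_gchoose_eq_0:
  fixes p :: "'a :: field_char_0"
  assumes "odd n"
  shows "(\<Sum>m=0..n. 2 ^ (n - m) * (p gchoose (n - m)) * ((of_nat n - 1 - 2 * p) gchoose m)) = 0"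
proof -
  define G :: "'a \<Rightarrow> 'a \<Rightarrow> nat \<Rightarrow> 'a poly"
    where "G c d k = smult (inverse (fact k)) (\<Prod>i=0..<k. [:c - of_nat i, d:])" for c d k
  define Q where "Q = (\<Sum>m=0..n. smult (2 ^ (n - m)) (G 0 1 (n - m) * G (of_nat n - 1) (- 2) m))"
  have Q: "poly Q x =
      (\<Sum>m=0..n. 2 ^ (n - m) * (x gchoose (n - m)) * ((of_nat n - 1 - 2 * x) gchoose m))" for x
    using gchoose_linear_eq_poly[of 0 1 x, folded G_def]
      gchoose_linear_eq_poly[of "of_nat n - 1" "- 2" x, folded G_def]
    by (simp add: Q_def poly_sum mult.assoc)
  \<comment> \<open>In characteristic 0 the naturals give infinitely many roots, which forces
    \<open>Q = 0\<close>.\<close>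
  have "range of_nat \<subseteq> {x. poly Q x = 0}"
    using sum_gchoose_of_nat_eq_0[OF assms] by (auto simp: Q)
  moreover have "infinite (range (of_nat :: nat \<Rightarrow> 'a))"
    by (simp add: finite_image_iff inj_of_nat)
  ultimately have "Q = 0"
    using poly_roots_finite finite_subset by blast
  then show ?thesis
    using Q[of p] by simp
qed

text \<open>Choosing the \<open>2 * j\<close> matched vertices first makes
  \<open>matching_number k j\<close> a constant times \<open>k gchoose (2 * j)\<close>; trinomial
  revision then confines \<open>k\<close> to the last factor.\<close>

lemma gchoose_mult_matching_number:
  assumes "2 * j \<le> k"
  shows "(\<alpha> gchoose k) * matching_number k j =
    fact (2 * j) / (fact j * 2 ^ j) * (\<alpha> gchoose (2 * j)) * ((\<alpha> - of_nat (2 * j)) gchoose (k - 2 * j))"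
proof -
  have "matching_number k j = fact (2 * j) / (fact j * 2 ^ j) * (of_nat k gchoose (2 * j))"
    using assms
    by (simp add: matching_number_def binomial_fact field_simps flip: binomial_gbinomial)
  then show ?thesis
    using gbinomial_trinomial_revision[OF assms, of \<alpha>] by (simp add: mult_ac)
qed

theorem corollary6p3:
  fixes r j :: nat and \<alpha> p :: complex
  assumes "odd r"
    and "j \<le> r div 2"
    and "p = (of_nat r - 1 - \<alpha>) / 2"
  shows "(\<Sum>k = 2 * j..r.
            2 ^ (r - k) * (p gchoose (r - k)) * (\<alpha> gchoose k) * matching_number k j) = 0"
proof -
  define n where "n = r - 2 * j"
  define C where "C = fact (2 * j) / (fact j * 2 ^ j) * (\<alpha> gchoose (2 * j))"
  have r: "r = n + 2 * j" and "odd n"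
    using assms(1,2) by (auto simp: n_def)
  have \<beta>: "\<alpha> - of_nat (2 * j) = of_nat n - 1 - 2 * p"
    by (simp add: assms(3) r field_simps)
  have "(\<Sum>k = 2 * j..r. 2 ^ (r - k) * (p gchoose (r - k)) * (\<alpha> gchoose k) * matching_number k j) =
      (\<Sum>k = 0 + 2 * j..n + 2 * j. C * (2 ^ (r - k) * (p gchoose (r - k)) *
        ((of_nat n - 1 - 2 * p) gchoose (k - 2 * j))))"
    unfolding r by (intro sum.cong)
      (auto simp: gchoose_mult_matching_number \<beta> C_def mult.assoc mult.left_commute
        simp del: of_nat_mult)
  also have "\<dots> = C * (\<Sum>m = 0..n. 2 ^ (n - m) * (p gchoose (n - m)) *
      ((of_nat n - 1 - 2 * p) gchoose m))"
    \<comment> \<open>Substituting \<open>k = m + 2 * j\<close> turns \<open>r - k\<close> into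
      \<open>n - m\<close>.\<close>
    unfolding sum.shift_bounds_cl_nat_ivl by (simp add: r sum_distrib_left)
  finally show ?thesis
    using sum_gchoose_eq_0[OF \<open>odd n\<close>, of p] by simp
qed

end
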